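(* There is an algorithm (GeneratePN) which, given $n$, lists every prefix normal word of length $n$ exactly once, in amortized $O(n)$ time per word listed. That is, its total running time is $O\big(n\cdot |\mathcal{L}_{\mathrm{PN}}\cap\{0,1\}^n|\big)$.
   Context: A binary word $w=w_1\cdots w_n\in\{0,1\}^n$ is prefix normal if for every $1\le i\le n$, no length-$i$ substring (factor) of $w$ contains more $1$s than the prefix $w_1\cdots w_i$. Equivalently, $F(w,i)=P(w,i)$ for all $i$, where $P(w,i)$ is the number of $1$s in $w_1\cdots w_i$ and $F(w,i)$ is the maximum number of $1$s over all length-$i$ substrings of $w$. $\mathcal{L}_{\mathrm{PN}}$ denotes the set of prefix normal words. The algorithm works as follows. For each density $d=0,1,\dots,n$, it starts at the word $1^d0^{n-d}$ and explores recursively. From a word $1^s0^t\gamma$ (with $s,t>0$ and $\gamma$ empty or starting with $1$), it considers the children $1^{s-1}0^i10^{t-i}\gamma$ for $i=1,2,\dots$ in increasing order of $i$. It recurses into each child as long as that child is prefix normal, and it stops at the first child that is not prefix normal. Each visited word is output. The algorithm maintains an array holding the function $F(\gamma,\cdot)$ for the fixed suffix $\gamma$. *)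

theory Defs
  imports Complex_Main "HOL-Library.Sublist" "HOL-Library.Landau_Symbols"
begin

section \<open>Prefix normal words\<close>

type_synonym word = "nat list"

definition ones :: "word \<Rightarrow> nat" where
  "ones u = count_list u 1"

definition P :: "word \<Rightarrow> nat \<Rightarrow> nat" where
  "P w i = ones (take i w)"

definition prefix_normal :: "word \<Rightarrow> bool" where
  "prefix_normal w \<longleftrightarrow>
     (\<forall>i\<in>{1..length w}. \<forall>u. sublist u w \<and> length u = i \<longrightarrow> ones u \<le> P w i)"

definition L_PN :: "word set" where
  "L_PN = {w. set w \<subseteq> {0, 1} \<and> prefix_normal w}"


section \<open>A unit-cost RAM language with recursive procedures\<close>

text \<open>
  Running time is measured in an imperative language over the natural numbers. Every constant,
  variable access, array access, comparison, addition and subtraction costs one time unit, and so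
  does every executed command, on top of the cost of the expressions it evaluates; writing out a
  word additionally costs its length. There is no multiplication, and no operation copies or
  compares whole arrays. Variables are local to a procedure activation, arrays are global.
  Subtraction is that of type \<^typ>\<open>nat\<close>, i.e. truncated at zero.
\<close>

type_synonym name = string
type_synonym locals = "name \<Rightarrow> nat"
type_synonym arrays = "name \<Rightarrow> nat \<Rightarrow> nat"

datatype aexp =
    N nat
  | V name
  | Arr name aexp
  | Plus aexp aexp
  | Minus aexp aexp

datatype bexp =
    Less aexp aexp
  | Leq aexp aexp
  | And bexp bexp

datatype com =
    Skip
  | Assign name aexp              ("_ ::= _" [1000, 61] 61)
  | Store name aexp aexp
  | Output name aexp aexp
  | Seq com com                   (infixr ";;" 60)
  | If bexp com com               ("(IF _/ THEN _/ ELSE _)" [0, 0, 61] 61)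
  | While bexp com                ("(WHILE _/ DO _)" [0, 61] 61)
  | Call name "aexp list"

text \<open>A program maps procedure names to formal parameters and bodies.\<close>

type_synonym program = "name \<Rightarrow> (name list \<times> com) option"

fun aval :: "aexp \<Rightarrow> locals \<Rightarrow> arrays \<Rightarrow> nat" where
  "aval (N k) l m = k"
| "aval (V x) l m = l x"
| "aval (Arr a e) l m = m a (aval e l m)"
| "aval (Plus e1 e2) l m = aval e1 l m + aval e2 l m"
| "aval (Minus e1 e2) l m = aval e1 l m - aval e2 l m"

fun acost :: "aexp \<Rightarrow> nat" where
  "acost (N k) = 1"
| "acost (V x) = 1"
| "acost (Arr a e) = 1 + acost e"
| "acost (Plus e1 e2) = 1 + acost e1 + acost e2"
| "acost (Minus e1 e2) = 1 + acost e1 + acost e2"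

fun bval :: "bexp \<Rightarrow> locals \<Rightarrow> arrays \<Rightarrow> bool" where
  "bval (Less e1 e2) l m \<longleftrightarrow> aval e1 l m < aval e2 l m"
| "bval (Leq e1 e2) l m \<longleftrightarrow> aval e1 l m \<le> aval e2 l m"
| "bval (And b1 b2) l m \<longleftrightarrow> bval b1 l m \<and> bval b2 l m"

fun bcost :: "bexp \<Rightarrow> nat" where
  "bcost (Less e1 e2) = 1 + acost e1 + acost e2"
| "bcost (Leq e1 e2) = 1 + acost e1 + acost e2"
| "bcost (And b1 b2) = 1 + bcost b1 + bcost b2"

definition frame :: "name list \<Rightarrow> nat list \<Rightarrow> locals" where
  "frame xs vs = (\<lambda>x. case map_of (zip xs vs) x of Some v \<Rightarrow> v | None \<Rightarrow> 0)"

definition slice :: "(nat \<Rightarrow> nat) \<Rightarrow> nat \<Rightarrow> nat \<Rightarrow> nat list" where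
  "slice A i k = map A [i..<i + k]"

text \<open>
  \<open>exec pr c l m l' m' ws t\<close>: started in locals \<open>l\<close> and arrays \<open>m\<close>, command \<open>c\<close> terminates in
  locals \<open>l'\<close> and arrays \<open>m'\<close> after \<open>t\<close> time units, having output the words \<open>ws\<close> in this order.
\<close>

inductive exec ::
  "program \<Rightarrow> com \<Rightarrow> locals \<Rightarrow> arrays \<Rightarrow> locals \<Rightarrow> arrays \<Rightarrow> word list \<Rightarrow> nat \<Rightarrow> bool"
  for pr :: program
where
  Skip: "exec pr Skip l m l m [] 1"
| Assign: "exec pr (x ::= e) l m (l(x := aval e l m)) m [] (1 + acost e)"
| Store: "exec pr (Store a e1 e2) l m l (m(a := (m a)(aval e1 l m := aval e2 l m))) []
            (1 + acost e1 + acost e2)"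
| Output: "exec pr (Output a e1 e2) l m l m [slice (m a) (aval e1 l m) (aval e2 l m)]
            (1 + acost e1 + acost e2 + aval e2 l m)"
| Seq: "\<lbrakk> exec pr c1 l m l1 m1 ws1 t1; exec pr c2 l1 m1 l2 m2 ws2 t2 \<rbrakk>
         \<Longrightarrow> exec pr (c1 ;; c2) l m l2 m2 (ws1 @ ws2) (1 + t1 + t2)"
| IfTrue: "\<lbrakk> bval b l m; exec pr c1 l m l' m' ws t \<rbrakk>
         \<Longrightarrow> exec pr (IF b THEN c1 ELSE c2) l m l' m' ws (1 + bcost b + t)"
| IfFalse: "\<lbrakk> \<not> bval b l m; exec pr c2 l m l' m' ws t \<rbrakk>
         \<Longrightarrow> exec pr (IF b THEN c1 ELSE c2) l m l' m' ws (1 + bcost b + t)"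
| WhileFalse: "\<not> bval b l m \<Longrightarrow> exec pr (WHILE b DO c) l m l m [] (1 + bcost b)"
| WhileTrue: "\<lbrakk> bval b l m; exec pr c l m l1 m1 ws1 t1;
                exec pr (WHILE b DO c) l1 m1 l2 m2 ws2 t2 \<rbrakk>
         \<Longrightarrow> exec pr (WHILE b DO c) l m l2 m2 (ws1 @ ws2) (1 + bcost b + t1 + t2)"
| Call: "\<lbrakk> pr f = Some (xs, c); length xs = length es;
           exec pr c (frame xs (map (\<lambda>e. aval e l m) es)) m l' m' ws t \<rbrakk>
         \<Longrightarrow> exec pr (Call f es) l m l m' ws (1 + sum_list (map acost es) + t)"

inductive_cases SkipE: "exec pr Skip l m l' m' ws t"
inductive_cases AssignE: "exec pr (x ::= e) l m l' m' ws t"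
inductive_cases StoreE: "exec pr (Store a e1 e2) l m l' m' ws t"
inductive_cases OutputE: "exec pr (Output a e1 e2) l m l' m' ws t"
inductive_cases SeqE: "exec pr (c1 ;; c2) l m l' m' ws t"
inductive_cases IfE: "exec pr (IF b THEN c1 ELSE c2) l m l' m' ws t"
inductive_cases WhileE: "exec pr (WHILE b DO c) l m l' m' ws t"
inductive_cases CallE: "exec pr (Call f es) l m l' m' ws t"

lemma exec_deterministic:
  "exec pr c l m l1 m1 ws1 t1 \<Longrightarrow> exec pr c l m l2 m2 ws2 t2
     \<Longrightarrow> l1 = l2 \<and> m1 = m2 \<and> ws1 = ws2 \<and> t1 = t2"
proof (induction arbitrary: l2 m2 ws2 t2 rule: exec.induct)
  case Skip then show ?case by (auto elim: SkipE)
next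
  case Assign then show ?case by (auto elim: AssignE)
next
  case Store then show ?case by (auto elim: StoreE)
next
  case Output then show ?case by (auto elim: OutputE)
next
  case Seq
  from Seq.prems show ?case by (rule SeqE) (use Seq.IH in fastforce)
next
  case IfTrue
  from IfTrue.prems show ?case by (rule IfE) (use IfTrue in fastforce)+
next
  case IfFalse
  from IfFalse.prems show ?case by (rule IfE) (use IfFalse in fastforce)+
next
  case WhileFalse
  from WhileFalse.prems show ?case by (rule WhileE) (use WhileFalse in auto)+
next
  case WhileTrue
  from WhileTrue.prems show ?case by (rule WhileE) (use WhileTrue in fastforce)+
next
  case Call
  from Call.prems show ?case by (rule CallE) (use Call in fastforce)
qed

text \<open>
  \<open>runs pr f n ws t\<close>: calling the one-argument procedure \<open>f\<close> of \<open>pr\<close> on input \<open>n\<close>, with all arrays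
  zero, outputs exactly the list of words \<open>ws\<close> and halts after \<open>t\<close> time units.
\<close>

definition runs :: "program \<Rightarrow> name \<Rightarrow> nat \<Rightarrow> word list \<Rightarrow> nat \<Rightarrow> bool" where
  "runs pr f n ws t \<longleftrightarrow>
     (\<exists>m'. exec pr (Call f [V ''n'']) (frame [''n''] [n]) (\<lambda>_ _. 0)
               (frame [''n''] [n]) m' ws t)"


section \<open>The algorithm\<close>

text \<open>
  In a call \<open>Gen n s t b\<close> the cells \<open>0..<n\<close> of array \<open>w\<close> contain the current word
  \<open>1\<^sup>s0\<^sup>t\<gamma>\<close>, and cells \<open>b+1..b+n\<close> of array \<open>F\<close> contain \<open>F(\<gamma>,j)\<close> for \<open>1 \<le> j \<le> n\<close>, read as
  \<open>F(\<gamma>,\<bar>\<gamma>\<bar>)\<close> when \<open>j > \<bar>\<gamma>\<bar>\<close>. Each level of the recursion uses its own row of \<open>F\<close>, starting at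
  offset \<open>b\<close>; the next row starts at \<open>b + n + 1\<close>. All numbers and array indices that occur are
  bounded by a constant times \<open>(n+1)\<^sup>2\<close>, which justifies the unit-cost measure.

  For a child \<open>1\<^bsup>s-1\<^esup>0\<^sup>i\<gamma>'\<close>, where \<open>\<gamma>' = 10\<^bsup>t-i\<^esup>\<gamma>\<close> starts at cell \<open>s-1+i\<close>, a factor of \<open>\<gamma>'\<close>
  is a prefix of \<open>\<gamma>'\<close> or has all its 1s in \<open>\<gamma>\<close>. Hence \<open>F(\<gamma>',j) = max (F(\<gamma>,j)) (P(\<gamma>',j))\<close>.
  Factors of the child that start before \<open>\<gamma>'\<close> cannot violate prefix normality unless one inside
  \<open>\<gamma>'\<close> does, so the child is prefix normal iff its prefixes of length \<open>j\<close> have at least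
  \<open>F(\<gamma>',j)\<close> many 1s for all \<open>j\<close>.
\<close>

text \<open>
  Fills the \<open>F\<close>-row of the suffix starting at cell \<open>p\<close> of \<open>w\<close> and leaves \<open>ok = 1\<close> iff the word
  in \<open>w\<close> is prefix normal. Throughout, \<open>x\<close> and \<open>y\<close> count the 1s in the first \<open>j\<close> cells of the word
  and of the suffix, respectively.
\<close>

definition test_child :: com where
  "test_child =
     ''p'' ::= Plus (Minus (V ''s'') (N 1)) (V ''i'') ;;
     ''c'' ::= Plus (Plus (V ''b'') (V ''n'')) (N 1) ;;
     ''x'' ::= N 0 ;;
     ''y'' ::= N 0 ;;
     ''j'' ::= N 0 ;;
     ''ok'' ::= N 1 ;;
     WHILE Less (V ''j'') (V ''n'') DO (
       ''x'' ::= Plus (V ''x'') (Arr ''w'' (V ''j'')) ;;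
       (IF Less (Plus (V ''p'') (V ''j'')) (V ''n'')
        THEN ''y'' ::= Plus (V ''y'') (Arr ''w'' (Plus (V ''p'') (V ''j'')))
        ELSE Skip) ;;
       ''j'' ::= Plus (V ''j'') (N 1) ;;
       ''f'' ::= Arr ''F'' (Plus (V ''b'') (V ''j'')) ;;
       (IF Less (V ''f'') (V ''y'') THEN ''f'' ::= V ''y'' ELSE Skip) ;;
       Store ''F'' (Plus (V ''c'') (V ''j'')) (V ''f'') ;;
       (IF Less (V ''x'') (V ''f'') THEN ''ok'' ::= N 0 ELSE Skip))"

definition gen_body :: com where
  "gen_body =
     Output ''w'' (N 0) (V ''n'') ;;
     (IF And (Less (N 0) (V ''s'')) (Less (N 0) (V ''t''))
      THEN
        Store ''w'' (Minus (V ''s'') (N 1)) (N 0) ;;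
        ''i'' ::= N 1 ;;
        ''ok'' ::= N 1 ;;
        (WHILE And (Less (N 0) (V ''ok'')) (Leq (V ''i'') (V ''t'')) DO (
           Store ''w'' (Plus (Minus (V ''s'') (N 1)) (V ''i'')) (N 1) ;;
           test_child ;;
           (IF Less (N 0) (V ''ok'')
            THEN Call ''Gen'' [V ''n'', Minus (V ''s'') (N 1), V ''i'', V ''c'']
            ELSE Skip) ;;
           Store ''w'' (Plus (Minus (V ''s'') (N 1)) (V ''i'')) (N 0) ;;
           ''i'' ::= Plus (V ''i'') (N 1))) ;;
        Store ''w'' (Minus (V ''s'') (N 1)) (N 1)
      ELSE Skip)"

definition main_body :: com where
  "main_body =
     ''d'' ::= N 0 ;;
     WHILE Leq (V ''d'') (V ''n'') DO (
       ''j'' ::= N 0 ;;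
       (WHILE Less (V ''j'') (V ''n'') DO (
          (IF Less (V ''j'') (V ''d'')
           THEN Store ''w'' (V ''j'') (N 1)
           ELSE Store ''w'' (V ''j'') (N 0)) ;;
          ''j'' ::= Plus (V ''j'') (N 1) ;;
          Store ''F'' (V ''j'') (N 0))) ;;
       Call ''Gen'' [V ''n'', V ''d'', Minus (V ''n'') (V ''d''), N 0] ;;
       ''d'' ::= Plus (V ''d'') (N 1))"

definition GeneratePN :: program where
  "GeneratePN =
     [''GeneratePN'' \<mapsto> ([''n''], main_body),
      ''Gen'' \<mapsto> ([''n'', ''s'', ''t'', ''b''], gen_body)]"

end

theory Submission
  imports Defs
begin

text \<open>
  The call on \<open>1\<^sup>s0\<^sup>t\<gamma>\<close> lists the prefix normal words \<open>\<alpha>\<gamma>\<close> where \<open>\<alpha>\<close> has length \<open>s + t\<close> and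
  \<open>s\<close> ones. Apart from \<open>1\<^sup>s0\<^sup>t\<gamma>\<close> itself, these are split according to the last 1 of \<open>\<alpha>\<close>, and the
  part belonging to child \<open>i\<close> is empty as soon as some child \<open>i' \<le> i\<close> is not prefix normal; so
  stopping at the first failure loses nothing. A prefix normality test takes linear time,
  every successful test leads to a new word, and every call, which lists a word of its own, makes
  at most one failing test. Hence the number of tests is at most twice the number of words.
\<close>

section \<open>Combinatorics of prefix normal words\<close>

lemma ones_simps [simp]:
  "ones [] = 0"
  "ones (x # xs) = (if x = 1 then Suc (ones xs) else ones xs)"
  "ones (xs @ ys) = ones xs + ones ys"
  by (simp_all add: ones_def)

lemma ones_replicate [simp]: "ones (replicate k x) = (if x = 1 then k else 0)"
  by (induction k) auto

lemma ones_le_length: "ones u \<le> length u"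
  by (simp add: ones_def count_le_length)

lemma ones_eq_length: "ones u = length u \<Longrightarrow> u = replicate (length u) 1"
proof (induction u)
  case (Cons x u)
  then show ?case using ones_le_length[of u] by (auto split: if_splits)
qed simp

lemma P_0 [simp]: "P w 0 = 0" and P_Nil [simp]: "P [] j = 0"
  by (simp_all add: P_def)

lemma P_Cons_Suc [simp]: "P (x # w) (Suc j) = (if x = 1 then 1 else 0) + P w j"
  by (simp add: P_def)

text \<open>For binary words the letter read is itself the increment. The default 0 past the end
  corresponds to the guard \<open>p + j < n\<close> in the test.\<close>

lemma P_Suc: "set w \<subseteq> {0, 1} \<Longrightarrow> P w (Suc j) = P w j + (if j < length w then w ! j else 0)"
  by (auto simp: P_def take_Suc_conv_app_nth dest!: nth_mem)

lemma P_append: "P (xs @ ys) j = P xs j + P ys (j - length xs)"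
  by (simp add: P_def)

lemma P_mono: "i \<le> j \<Longrightarrow> P w i \<le> P w j"
  by (metis P_append P_def le_add1 le_Suc_ex ones_simps(3) take_add)

lemma P_le: "P w j \<le> j"
  using ones_le_length[of "take j w"] by (simp add: P_def)

lemma P_le_ones: "P w j \<le> ones w"
  by (metis P_def append_take_drop_id le_add1 ones_simps(3))

lemma P_replicate: "P (replicate k x) j = (if x = 1 then min j k else 0)"
  by (simp add: P_def min_def)

text \<open>A leading 1 pushes at most one letter out of the window, so it makes up for whatever is
  lost.\<close>

lemma P_Cons_one_ge: "P w j \<le> P (1 # w) j"
proof (cases j)
  case (Suc k)
  have "P w (Suc k) \<le> P w k + 1"
    by (cases "k < length w") (auto simp: P_def take_Suc_conv_app_nth)
  then show ?thesis using Suc by simp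
qed simp

lemma P_Cons_le: "x \<noteq> 1 \<Longrightarrow> P (x # w) j \<le> P w j"
  by (cases j) (auto simp: P_mono)

text \<open>The truncated windows at the end of \<open>w\<close> make this \<open>F(w, \<bar>w\<bar>)\<close> for \<open>j > \<bar>w\<bar>\<close>, the
  convention of the array \<open>F\<close>.\<close>

fun max_ones :: "word \<Rightarrow> nat \<Rightarrow> nat" where
  "max_ones [] j = 0"
| "max_ones (x # xs) j = max (P (x # xs) j) (max_ones xs j)"

lemma P_le_max_ones: "P w j \<le> max_ones w j"
  by (cases w) auto

lemma max_ones_append: "max_ones v j \<le> max_ones (u @ v) j"
  by (induction u) auto

text \<open>Turns the recursion into a quantifier over starting positions \<open>q\<close>; a
  \<open>q\<close> beyond the end yields an empty window and adds no condition.\<close>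

lemma max_ones_le_iff: "max_ones w j \<le> k \<longleftrightarrow> (\<forall>q. P (drop q w) j \<le> k)"
proof (induction w)
  case (Cons x w)
  have "(\<forall>q. P (drop q (x # w)) j \<le> k) \<longleftrightarrow> P (x # w) j \<le> k \<and> (\<forall>q. P (drop q w) j \<le> k)"
    by (metis drop_0 drop_Suc_Cons not0_implies_Suc)
  with Cons show ?case by simp
qed simp

lemma max_ones_zeros: "max_ones (replicate k 0 @ w) j = max_ones w j"
proof (induction k)
  case (Suc k)
  have "P (0 # replicate k 0 @ w) j \<le> max_ones (replicate k 0 @ w) j"
    using P_Cons_le[of 0] P_le_max_ones order_trans by fastforce
  with Suc show ?case by simp
qed simp

text \<open>A truncated window is a factor of smaller length. Prefix normality applies at that
  length, and monotonicity of \<open>P\<close> lifts the bound to \<open>j\<close>.\<close>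

lemma prefix_normal_iff:
  "prefix_normal w \<longleftrightarrow> (\<forall>j\<in>{1..length w}. max_ones w j \<le> P w j)"
proof
  assume pn: "prefix_normal w"
  show "\<forall>j\<in>{1..length w}. max_ones w j \<le> P w j"
  proof
    fix j assume j: "j \<in> {1..length w}"
    have "P (drop q w) j \<le> P w j" for q
    proof (cases "take j (drop q w) = []")
      case True
      then show ?thesis by (metis P_def le0 ones_simps(1))
    next
      case False
      let ?u = "take j (drop q w)"
      have "sublist ?u w"
        by (metis append_take_drop_id sublist_def)
      moreover have "length ?u \<in> {1..length w}"
        using False j by (auto simp: Suc_le_eq)
      ultimately have "ones ?u \<le> P w (length ?u)"
        using pn unfolding prefix_normal_def by blast
      also have "\<dots> \<le> P w j" by (simp add: P_mono)
      finally show ?thesis by (simp add: P_def)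
    qed
    then show "max_ones w j \<le> P w j" by (simp add: max_ones_le_iff)
  qed
next
  assume *: "\<forall>j\<in>{1..length w}. max_ones w j \<le> P w j"
  show "prefix_normal w"
    unfolding prefix_normal_def
  proof (intro ballI allI impI)
    fix i u assume i: "i \<in> {1..length w}" and u: "sublist u w \<and> length u = i"
    then obtain a b where w: "w = a @ u @ b" by (auto simp: sublist_def)
    have "ones u = P (drop (length a) w) i" using u w by (simp add: P_def)
    then show "ones u \<le> P w i" using * i by (metis max_ones_le_iff)
  qed
qed

text \<open>By \<open>P_Cons_one_ge\<close>, among the windows that start inside the block of 1s the
  one at the very front is the heaviest.\<close>

lemma max_ones_replicate_one:
  "max_ones (replicate a 1 @ w) j \<le> max (max_ones w j) (P (replicate a 1 @ w) j)"
proof (induction a)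
  case (Suc a)
  then show ?case using P_Cons_one_ge[of "replicate a 1 @ w" j] by simp
qed simp

text \<open>Windows starting in the 1s are dominated by the prefix, those starting in the 0s by a
  window of \<gamma>. This is why a test only has to compare prefix counts with the
  \<open>F\<close>-row of the suffix.\<close>

lemma prefix_normal_block_iff:
  fixes a i :: nat and \<gamma> :: word
  defines "v \<equiv> replicate a 1 @ replicate i 0 @ \<gamma>"
  shows "prefix_normal v \<longleftrightarrow> (\<forall>j\<in>{1..length v}. max_ones \<gamma> j \<le> P v j)"
proof -
  have "max_ones \<gamma> j \<le> max_ones v j" for j
    using max_ones_append[of \<gamma> j "replicate a 1 @ replicate i 0"] by (simp add: v_def)
  moreover have "max_ones v j \<le> max (max_ones \<gamma> j) (P v j)" for j
    using max_ones_replicate_one[of a "replicate i 0 @ \<gamma>" j] by (simp add: v_def max_ones_zeros)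
  ultimately show ?thesis
    unfolding prefix_normal_iff by (metis max.absorb2 max.cobounded2 order.trans)
qed

section \<open>The search tree: roots, children and descendants\<close>

lemma prefix_normal_root: "prefix_normal (replicate s 1 @ replicate t 0)"
  using prefix_normal_block_iff[of s t "[]"] by simp

text \<open>The parent is \<open>1^(s+1) 0^t \<gamma>\<close>: here \<open>s\<close> counts the 1s
  that stay in front, which avoids subtraction. For \<open>i = 0\<close> the formula gives the
  parent itself.\<close>

definition child :: "nat \<Rightarrow> nat \<Rightarrow> nat \<Rightarrow> word \<Rightarrow> word" where
  "child s i t \<gamma> = replicate s 1 @ replicate i 0 @ 1 # replicate (t - i) 0 @ \<gamma>"

text \<open>Describes what a call has to list without mentioning the search; the matching recursion
  is \<open>descendants_Suc\<close>.\<close>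

definition descendants :: "nat \<Rightarrow> nat \<Rightarrow> word \<Rightarrow> word set" where
  "descendants s t \<gamma> =
     {\<alpha> @ \<gamma> |\<alpha>. length \<alpha> = s + t \<and> ones \<alpha> = s \<and> set \<alpha> \<subseteq> {0, 1} \<and> prefix_normal (\<alpha> @ \<gamma>)}"

abbreviation sub_desc :: "nat \<Rightarrow> nat \<Rightarrow> nat \<Rightarrow> word \<Rightarrow> word set" where
  "sub_desc s i t \<gamma> \<equiv> descendants s i (1 # replicate (t - i) 0 @ \<gamma>)"

lemma no_ones: "set u \<subseteq> {0, 1} \<Longrightarrow> ones u = 0 \<Longrightarrow> u = replicate (length u) 0"
  by (induction u) (auto split: if_splits)

text \<open>Together with \<open>descendants_no_zeros\<close> this covers the leaves of the
  recursion, where the guard of \<open>gen_body\<close> fails.\<close>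

lemma descendants_0:
  "descendants 0 t \<gamma> = {w. w = replicate t 0 @ \<gamma> \<and> prefix_normal w}"
  using no_ones by (fastforce simp: descendants_def)

lemma descendants_no_zeros:
  "descendants s 0 \<gamma> = {w. w = replicate s 1 @ \<gamma> \<and> prefix_normal w}"
  using ones_eq_length by (fastforce simp: descendants_def)

text \<open>A descendant other than the root belongs to the child given by the position \<open>s + i\<close> of the
  last 1 before \<open>\<gamma>\<close>.\<close>

lemma descendants_Suc:
  "descendants (Suc s) t \<gamma> =
     {w. w = replicate (Suc s) 1 @ replicate t 0 @ \<gamma> \<and> prefix_normal w} \<union>
     (\<Union>i\<in>{1..t}. sub_desc s i t \<gamma>)" (is "?L = ?A \<union> ?B")
proof (intro equalityI subsetI)
  fix w assume "w \<in> ?L"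
  then obtain \<alpha> where a: "w = \<alpha> @ \<gamma>" "length \<alpha> = Suc s + t" "ones \<alpha> = Suc s" "set \<alpha> \<subseteq> {0, 1}"
      "prefix_normal w"
    by (auto simp: descendants_def)
  then have "1 \<in> set \<alpha>" by (metis count_notin nat.distinct(1) ones_def)
  then obtain ys zs where yz: "\<alpha> = ys @ 1 # zs" "1 \<notin> set zs"
    by (metis split_list_last)
  have zs: "zs = replicate (length zs) 0"
    using a yz by (intro no_ones) (auto simp: ones_def)
  then have "ones zs = 0" by (metis ones_replicate zero_neq_one)
  then have ys: "ones ys = s" "set ys \<subseteq> {0, 1}" "length ys + length zs = s + t"
    using a yz by auto
  define i where "i = length ys - s"
  have "s \<le> length ys" using ones_le_length[of ys] ys by simp
  then have i: "length ys = s + i" "length zs = t - i" "i \<le> t" using ys by (auto simp: i_def)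
  show "w \<in> ?A \<union> ?B"
  \<comment> \<open>If \<open>i = 0\<close>, then \<open>ys\<close> has as many 1s as letters, so
    \<open>w\<close> is the root.\<close>
  proof (cases "i = 0")
    case True
    then have "ys = replicate s 1" using ones_eq_length[of ys] i ys by simp
    then have "w = replicate s 1 @ 1 # replicate t 0 @ \<gamma>" using a yz zs i True by simp
    then show ?thesis using a(5) by (simp add: replicate_append_same[symmetric])
  next
    case False
    have "w = ys @ 1 # replicate (t - i) 0 @ \<gamma>" using a yz zs i by simp
    with a(5) ys i have "w \<in> sub_desc s i t \<gamma>" by (auto simp: descendants_def)
    with i False show ?thesis by auto
  qed
next
  fix w assume "w \<in> ?A \<union> ?B"
  then consider "w \<in> ?A" | i where "i \<in> {1..t}" "w \<in> sub_desc s i t \<gamma>" by blast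
  then show "w \<in> ?L"
  proof cases
    case 1
    then show ?thesis unfolding descendants_def
      by (auto intro!: exI[of _ "replicate (Suc s) 1 @ replicate t 0"])
  next
    case 2
    then obtain \<beta> where b: "w = \<beta> @ 1 # replicate (t - i) 0 @ \<gamma>" "length \<beta> = s + i" "ones \<beta> = s"
        "set \<beta> \<subseteq> {0, 1}" "prefix_normal w"
      by (auto simp: descendants_def)
    then show ?thesis using 2 unfolding descendants_def
      by (auto intro!: exI[of _ "\<beta> @ 1 # replicate (t - i) 0"])
  qed
qed

text \<open>Cell \<open>s + i\<close> separates them: it holds 0 in the root, as \<open>i\<close> is
  at least 1, but 1 in every word of the part.\<close>

lemma root_notin_sub_desc:
  assumes "i \<in> {1..t}"
  shows "replicate (Suc s) 1 @ replicate t 0 @ \<gamma> \<notin> sub_desc s i t \<gamma>"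
proof
  assume "replicate (Suc s) 1 @ replicate t 0 @ \<gamma> \<in> sub_desc s i t \<gamma>"
  then obtain \<beta> where b: "replicate (Suc s) 1 @ replicate t 0 @ \<gamma> = \<beta> @ 1 # replicate (t - i) 0 @ \<gamma>"
      "length \<beta> = s + i"
    by (auto simp: descendants_def)
  have "(replicate (Suc s) 1 @ replicate t 0 @ \<gamma>) ! (s + i) = (0::nat)"
    using assms by (auto simp del: replicate_Suc simp: nth_append)
  moreover have "(\<beta> @ 1 # replicate (t - i) 0 @ \<gamma>) ! (s + i) = 1"
    using b(2) by (simp add: nth_append)
  ultimately show False using b(1) by (metis zero_neq_one)
qed

text \<open>Cell \<open>s + i'\<close> lies in the gap of 0s for the smaller index, while it holds
  the last 1 before \<gamma> for the larger one.\<close>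

lemma sub_desc_disjoint:
  assumes "i < i'" "i' \<le> t"
  shows "sub_desc s i t \<gamma> \<inter> sub_desc s i' t \<gamma> = {}"
proof (rule ccontr)
  assume "\<not> ?thesis"
  then obtain \<beta> \<beta>' where b: "\<beta> @ 1 # replicate (t - i) 0 @ \<gamma> = \<beta>' @ 1 # replicate (t - i') 0 @ \<gamma>"
      "length \<beta> = s + i" "length \<beta>' = s + i'"
    unfolding descendants_def by force
  have "(\<beta> @ 1 # replicate (t - i) 0 @ \<gamma>) ! (s + i') = 0"
    using assms b(2) by (auto simp: nth_append nth_Cons')
  moreover have "(\<beta>' @ 1 # replicate (t - i') 0 @ \<gamma>) ! (s + i') = 1"
    using b(3) by (simp add: nth_append)
  ultimately show False using b(1) by (metis zero_neq_one)
qed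

text \<open>A longer gap pushes more of \<gamma> out of the window. Moving the last 1 to the left
  lengthens the gap in just this way.\<close>

lemma P_gap_antimono:
  assumes "k \<le> k'"
  shows "P (1 # replicate k' 0 @ \<gamma>) j \<le> P (1 # replicate k 0 @ \<gamma>) j"
proof (cases j)
  case (Suc j')
  have "P \<gamma> (j' - k') \<le> P \<gamma> (j' - k)" using assms by (intro P_mono) simp
  then show ?thesis using Suc by (simp add: P_append P_replicate)
qed simp

text \<open>Why the search may stop at the first child that is not prefix normal: pulling the last 1 of
  the block before \<open>\<gamma>\<close> to the left and the remaining 1s to the front increases all prefix counts,
  while no window of the new suffix beats the corresponding window of the old one.\<close>

lemma child_prefix_normal:
  assumes "sub_desc s i' t \<gamma> \<noteq> {}" "i \<le> i'" "i' \<le> t"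
  shows "prefix_normal (child s i t \<gamma>)"
proof -
  obtain \<beta> where b: "length \<beta> = s + i'" "ones \<beta> = s" "set \<beta> \<subseteq> {0, 1}"
      "prefix_normal (\<beta> @ 1 # replicate (t - i') 0 @ \<gamma>)"
    using assms(1) by (auto simp: descendants_def)
  define u where "u = \<beta> @ 1 # replicate (t - i') 0 @ \<gamma>"
  define v where "v = child s i t \<gamma>"
  have len: "length u = length v" using assms b by (simp add: u_def v_def child_def)
  have uv: "P u j \<le> P v j" for j
  proof -
    \<comment> \<open>In both words \<gamma> begins at cell \<open>s + t + 1\<close>, so only the
      parts before it are compared: the first \<open>j\<close> letters of \<open>\<beta>\<close>
      contain at most \<open>min j s\<close> 1s, and the 1 after the block comes no later in
      \<open>v\<close> than in \<open>u\<close>.\<close>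
    have Pv: "P v j = min j s + P (1 # replicate (t - i) 0) (j - (s + i)) + P \<gamma> (j - (s + t + 1))"
      using assms by (simp add: v_def child_def P_append[of "_ # _", simplified] P_append P_replicate)
    have Pu: "P u j = P \<beta> j + P (1 # replicate (t - i') 0) (j - (s + i')) + P \<gamma> (j - (s + t + 1))"
      using assms b by (simp add: u_def P_append[of "_ # _", simplified] P_append P_replicate)
    have "P \<beta> j \<le> min j s" using P_le[of \<beta> j] P_le_ones[of \<beta> j] b by simp
    moreover have "P (1 # replicate (t - i') 0) (j - (s + i')) \<le> P (1 # replicate (t - i) 0) (j - (s + i))"
      using assms by (cases "j - (s + i')"; cases "j - (s + i)") (auto simp: P_replicate)
    ultimately show ?thesis using Pu Pv by linarith
  qed
  have "max_ones (1 # replicate (t - i) 0 @ \<gamma>) j \<le> P v j" if j: "j \<in> {1..length v}" for j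
  proof -
    have "max_ones (1 # replicate (t - i') 0 @ \<gamma>) j \<le> max_ones u j"
      using max_ones_append unfolding u_def by blast
    also have "\<dots> \<le> P u j" using b(4) j len unfolding u_def[symmetric] prefix_normal_iff by simp
    also note uv
    finally show ?thesis
      using P_gap_antimono[of "t - i'" "t - i" \<gamma> j] assms by (simp add: max_ones_zeros diff_le_mono2)
  qed
  then show ?thesis
    unfolding v_def child_def by (subst prefix_normal_block_iff) auto
qed

lemma root_descendants:
  "{w \<in> L_PN. length w = n \<and> ones w = d} =
     (if d \<le> n then descendants d (n - d) [] else {})"
  using ones_le_length by (auto simp: descendants_def L_PN_def)

section \<open>Weakest preconditions with running time\<close>

text \<open>The existential asserts termination; since \<open>exec\<close> is deterministic, the run
  it provides is the only one. Output and time are arguments of the postcondition, so correctness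
  and cost are proved together.\<close>

definition wp ::
  "program \<Rightarrow> com \<Rightarrow> locals \<Rightarrow> arrays \<Rightarrow> (locals \<Rightarrow> arrays \<Rightarrow> word list \<Rightarrow> nat \<Rightarrow> bool) \<Rightarrow> bool" where
  "wp pr c l m Q \<longleftrightarrow> (\<exists>l' m' ws t. exec pr c l m l' m' ws t \<and> Q l' m' ws t)"

lemma wpI: "exec pr c l m l' m' ws t \<Longrightarrow> Q l' m' ws t \<Longrightarrow> wp pr c l m Q"
  unfolding wp_def by (intro exI conjI)

lemma wpE:
  assumes "wp pr c l m Q"
  obtains l' m' ws t where "exec pr c l m l' m' ws t" "Q l' m' ws t"
  using assms unfolding wp_def by (elim exE conjE)

lemma wp_mono:
  assumes "wp pr c l m Q" and "\<And>l' m' ws t. Q l' m' ws t \<Longrightarrow> Q' l' m' ws t"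
  shows "wp pr c l m Q'"
  using assms(1) by (rule wpE) (rule wpI, assumption, rule assms(2))

lemma wp_Skip [simp]: "wp pr Skip l m Q \<longleftrightarrow> Q l m [] 1"
  by (rule iffI, erule wpE, erule SkipE, simp, rule wpI[OF exec.Skip])

lemma wp_Assign [simp]: "wp pr (x ::= e) l m Q \<longleftrightarrow> Q (l(x := aval e l m)) m [] (1 + acost e)"
  by (rule iffI, erule wpE, erule AssignE, simp, rule wpI[OF exec.Assign])

lemma wp_Store [simp]:
  "wp pr (Store a e1 e2) l m Q \<longleftrightarrow>
     Q l (m(a := (m a)(aval e1 l m := aval e2 l m))) [] (1 + acost e1 + acost e2)"
  by (rule iffI, erule wpE, erule StoreE, simp, rule wpI[OF exec.Store])

lemma wp_Output [simp]:
  "wp pr (Output a e1 e2) l m Q \<longleftrightarrow>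
     Q l m [slice (m a) (aval e1 l m) (aval e2 l m)] (1 + acost e1 + acost e2 + aval e2 l m)"
  by (rule iffI, erule wpE, erule OutputE, simp, rule wpI[OF exec.Output])

lemma wp_Seq [simp]:
  "wp pr (c1 ;; c2) l m Q \<longleftrightarrow>
     wp pr c1 l m (\<lambda>l1 m1 ws1 t1. wp pr c2 l1 m1 (\<lambda>l2 m2 ws2 t2. Q l2 m2 (ws1 @ ws2) (1 + t1 + t2)))"
  by (rule iffI, erule wpE, erule SeqE, rule wpI, assumption, rule wpI, assumption, simp)
     (elim wpE, rule wpI[OF exec.Seq])

lemma wp_If [simp]:
  "wp pr (IF b THEN c1 ELSE c2) l m Q \<longleftrightarrow>
     (if bval b l m then wp pr c1 l m (\<lambda>l' m' ws t. Q l' m' ws (1 + bcost b + t))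
      else wp pr c2 l m (\<lambda>l' m' ws t. Q l' m' ws (1 + bcost b + t)))"
proof (cases "bval b l m")
  case True
  then show ?thesis
    by (simp del: One_nat_def, intro iffI)
       (erule wpE, erule IfE, rule wpI, assumption, simp_all, elim wpE, rule wpI[OF exec.IfTrue], simp_all)
next
  case False
  then show ?thesis
    by (simp del: One_nat_def, intro iffI)
       (erule wpE, erule IfE, simp, rule wpI, assumption, simp_all, elim wpE, rule wpI[OF exec.IfFalse], simp_all)
qed

text \<open>Not a simp rule, since the right-hand side contains the same loop again; it is unfolded
  once per induction step.\<close>

lemma wp_While:
  "wp pr (WHILE b DO c) l m Q \<longleftrightarrow>
     (if bval b l m
      then wp pr c l m (\<lambda>l1 m1 ws1 t1. wp pr (WHILE b DO c) l1 m1
             (\<lambda>l2 m2 ws2 t2. Q l2 m2 (ws1 @ ws2) (1 + bcost b + t1 + t2)))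
      else Q l m [] (1 + bcost b))"
proof (cases "bval b l m")
  case True
  then show ?thesis
    by (simp del: One_nat_def, intro iffI)
       (erule wpE, erule WhileE, simp, rule wpI, assumption, rule wpI, assumption, simp,
        elim wpE, rule wpI[OF exec.WhileTrue], simp_all)
next
  case False
  then show ?thesis
    by (simp del: One_nat_def, intro iffI)
       (erule wpE, erule WhileE, simp, simp, rule wpI[OF exec.WhileFalse], simp_all)
qed

lemma wp_Call:
  assumes "pr f = Some (xs, c)" "length xs = length es"
  shows "wp pr (Call f es) l m Q \<longleftrightarrow>
     wp pr c (frame xs (map (\<lambda>e. aval e l m) es)) m
       (\<lambda>l' m' ws t. Q l m' ws (1 + sum_list (map acost es) + t))"
  by (rule iffI, erule wpE, erule CallE, use assms in simp, erule wpI, simp, elim wpE)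
     (rule wpI, rule exec.Call, rule assms, rule assms, assumption, assumption)

section \<open>Verification of the program\<close>

text \<open>The four loop bodies of the program get names so that loop invariants can refer to them;
  \<open>tc\<close>, \<open>gen_body_unfold\<close> and \<open>body\<close> relate them to the
  original code.\<close>

definition test_step :: com where
  "test_step =
     ''x'' ::= Plus (V ''x'') (Arr ''w'' (V ''j'')) ;;
     (IF Less (Plus (V ''p'') (V ''j'')) (V ''n'')
      THEN ''y'' ::= Plus (V ''y'') (Arr ''w'' (Plus (V ''p'') (V ''j'')))
      ELSE Skip) ;;
     ''j'' ::= Plus (V ''j'') (N 1) ;;
     ''f'' ::= Arr ''F'' (Plus (V ''b'') (V ''j'')) ;;
     (IF Less (V ''f'') (V ''y'') THEN ''f'' ::= V ''y'' ELSE Skip) ;;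
     Store ''F'' (Plus (V ''c'') (V ''j'')) (V ''f'') ;;
     (IF Less (V ''x'') (V ''f'') THEN ''ok'' ::= N 0 ELSE Skip)"

definition gen_step :: com where
  "gen_step =
     Store ''w'' (Plus (Minus (V ''s'') (N 1)) (V ''i'')) (N 1) ;;
     test_child ;;
     (IF Less (N 0) (V ''ok'')
      THEN Call ''Gen'' [V ''n'', Minus (V ''s'') (N 1), V ''i'', V ''c'']
      ELSE Skip) ;;
     Store ''w'' (Plus (Minus (V ''s'') (N 1)) (V ''i'')) (N 0) ;;
     ''i'' ::= Plus (V ''i'') (N 1)"

definition init_step :: com where
  "init_step =
     (IF Less (V ''j'') (V ''d'')
      THEN Store ''w'' (V ''j'') (N 1)
      ELSE Store ''w'' (V ''j'') (N 0)) ;;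
     ''j'' ::= Plus (V ''j'') (N 1) ;;
     Store ''F'' (V ''j'') (N 0)"

definition main_step :: com where
  "main_step =
     ''j'' ::= N 0 ;;
     (WHILE Less (V ''j'') (V ''n'') DO init_step) ;;
     Call ''Gen'' [V ''n'', V ''d'', Minus (V ''n'') (V ''d''), N 0] ;;
     ''d'' ::= Plus (V ''d'') (N 1)"

text \<open>The counters \<open>x\<close>, \<open>y\<close> and \<open>j\<close> advance before
  \<open>F\<close> is read, so the step starting at \<open>j\<close> settles window length
  \<open>Suc j\<close>.\<close>

lemma test_step_wp:
  fixes l :: locals and m :: arrays
  defines "p \<equiv> l ''p''"
  assumes u: "map (m ''w'') [0..<n] = u" "set u \<subseteq> {0, 1}"
    and l: "l ''n'' = n" "l ''j'' = j" "l ''x'' = P u j" "l ''y'' = P (drop p u) j" "j < n"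
  defines "h \<equiv> max (m ''F'' (l ''b'' + Suc j)) (P (drop p u) (Suc j))"
  shows "wp pr test_step l m (\<lambda>l' m' ws T.
    l' = l(''x'' := P u (Suc j), ''y'' := P (drop p u) (Suc j), ''j'' := Suc j, ''f'' := h,
           ''ok'' := (if h \<le> P u (Suc j) then l ''ok'' else 0)) \<and>
    m' = m(''F'' := (m ''F'')(l ''c'' + Suc j := h)) \<and> ws = [] \<and> T \<le> 60)"
proof -
  have len: "length u = n" using u(1) by auto
  have nth: "u ! k = m ''w'' k" if "k < n" for k using that u(1) by auto
  have "set (drop p u) \<subseteq> {0, 1}" using u(2) set_drop_subset by fastforce
  note Ps = P_Suc[OF u(2)] P_Suc[OF this]
  have x: "P u (Suc j) = P u j + m ''w'' j" using l(5) len nth by (simp add: Ps)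
  have y: "P (drop p u) (Suc j) = P (drop p u) j + (if p + j < n then m ''w'' (p + j) else 0)"
    using len nth by (auto simp: Ps)
  show ?thesis
    unfolding test_step_def h_def x y using l
    by (auto simp: p_def fun_eq_iff max_def)
qed

text \<open>The condition \<open>l ''b'' + n < l ''c''\<close> keeps the row being read apart from
  the row being written. The bound of 70 per round is 60 for the body plus the guard.\<close>

lemma test_loop_wp:
  fixes l :: locals and m :: arrays
  assumes "map (m ''w'') [0..<n] = u" "set u \<subseteq> {0, 1}"
    and "l ''n'' = n" "l ''j'' = j" "l ''x'' = P u j" "l ''y'' = P (drop (l ''p'') u) j" "j \<le> n"
    and "l ''b'' + n < l ''c''"
  shows "wp pr (WHILE Less (V ''j'') (V ''n'') DO test_step) l m (\<lambda>l' m' ws T.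
    (\<forall>v. v \<notin> {''x'', ''y'', ''j'', ''f'', ''ok''} \<longrightarrow> l' v = l v) \<and>
    l' ''ok'' = (if \<forall>i\<in>{j<..n}. max (m ''F'' (l ''b'' + i)) (P (drop (l ''p'') u) i) \<le> P u i
                 then l ''ok'' else 0) \<and>
    m' ''w'' = m ''w'' \<and> (\<forall>k \<le> l ''c'' + j. m' ''F'' k = m ''F'' k) \<and>
    (\<forall>i\<in>{j<..n}. m' ''F'' (l ''c'' + i) =
       max (m ''F'' (l ''b'' + i)) (P (drop (l ''p'') u) i)) \<and>
    ws = [] \<and> T \<le> 70 * (n - j) + 10)"
  using assms
proof (induction "n - j" arbitrary: j l m)
  case 0
  then show ?case by (subst wp_While) auto
next
  case (Suc d)
  let ?h = "\<lambda>i. max (m ''F'' (l ''b'' + i)) (P (drop (l ''p'') u) i)"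
  have j: "j < n" using Suc by simp
  have split: "{j<..n} = insert (Suc j) {Suc j<..n}" using j by auto
  let ?l = "l(''x'' := P u (Suc j), ''y'' := P (drop (l ''p'') u) (Suc j), ''j'' := Suc j,
              ''f'' := ?h (Suc j), ''ok'' := (if ?h (Suc j) \<le> P u (Suc j) then l ''ok'' else 0))"
  let ?m = "m(''F'' := (m ''F'')(l ''c'' + Suc j := ?h (Suc j)))"
  have step: "wp pr test_step l m (\<lambda>l' m' ws T. l' = ?l \<and> m' = ?m \<and> ws = [] \<and> T \<le> 60)"
    by (rule test_step_wp) (use Suc.prems j in auto)
  have h: "?m ''F'' (?l ''b'' + i) = m ''F'' (l ''b'' + i)" if "i \<in> {Suc j<..n}" for i
    using that Suc.prems by auto
  have loop: "wp pr (WHILE Less (V ''j'') (V ''n'') DO test_step) ?l ?m (\<lambda>l' m' ws T.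
    (\<forall>v. v \<notin> {''x'', ''y'', ''j'', ''f'', ''ok''} \<longrightarrow> l' v = ?l v) \<and>
    l' ''ok'' = (if \<forall>i\<in>{Suc j<..n}. max (?m ''F'' (?l ''b'' + i)) (P (drop (?l ''p'') u) i) \<le> P u i
                 then ?l ''ok'' else 0) \<and>
    m' ''w'' = ?m ''w'' \<and> (\<forall>k \<le> ?l ''c'' + Suc j. m' ''F'' k = ?m ''F'' k) \<and>
    (\<forall>i\<in>{Suc j<..n}. m' ''F'' (?l ''c'' + i) =
       max (?m ''F'' (?l ''b'' + i)) (P (drop (?l ''p'') u) i)) \<and>
    ws = [] \<and> T \<le> 70 * (n - Suc j) + 10)"
    by (rule Suc.hyps(1)) (use Suc.hyps(2) Suc.prems j in auto)
  have time: "70 * (n - j) = 70 * (n - Suc j) + 70" using j by simp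
  show ?case
    apply (subst wp_While)
    apply (simp only: bval.simps aval.simps Suc.prems(3,4) j if_True)
    apply (rule wp_mono[OF step], elim conjE, hypsubst)
    apply (rule wp_mono[OF loop], elim conjE)
    unfolding split time using h
    by auto
qed

lemma test_child_wp:
  fixes l :: locals and m :: arrays
  assumes u: "map (m ''w'') [0..<n] = u" "set u \<subseteq> {0, 1}" and n: "l ''n'' = n"
    and s: "l ''s'' = Suc s"
  defines "h \<equiv> \<lambda>j. max (m ''F'' (l ''b'' + j)) (P (drop (s + l ''i'') u) j)"
  shows "wp pr test_child l m (\<lambda>l' m' ws T.
    (\<forall>v \<in> {''n'', ''s'', ''t'', ''b'', ''i''}. l' v = l v) \<and> l' ''c'' = l ''b'' + n + 1 \<and>
    l' ''ok'' = (if \<forall>j\<in>{1..n}. h j \<le> P u j then 1 else 0) \<and>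
    m' ''w'' = m ''w'' \<and> (\<forall>k \<le> l ''b'' + n + 1. m' ''F'' k = m ''F'' k) \<and>
    (\<forall>j\<in>{1..n}. m' ''F'' (l ''b'' + n + 1 + j) = h j) \<and>
    ws = [] \<and> T \<le> 70 * n + 50)"
proof -
  have tc: "test_child =
     ''p'' ::= Plus (Minus (V ''s'') (N 1)) (V ''i'') ;;
     ''c'' ::= Plus (Plus (V ''b'') (V ''n'')) (N 1) ;;
     ''x'' ::= N 0 ;;
     ''y'' ::= N 0 ;;
     ''j'' ::= N 0 ;;
     ''ok'' ::= N 1 ;;
     WHILE Less (V ''j'') (V ''n'') DO test_step"
    by (simp add: test_child_def test_step_def)
  have range: "{0<..n} = {1..n}" by auto
  show ?thesis
    unfolding tc wp_Seq wp_Assign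
    apply (rule wp_mono)
     apply (rule test_loop_wp[where n = n and u = u and j = 0])
    using u n s by (auto simp: h_def range)
qed

section \<open>Amortized analysis of the recursive procedure\<close>

definition budget :: "nat \<Rightarrow> nat" where
  "budget n = 200 * (n + 1)"

text \<open>In the bound on \<open>T\<close>, every listed word pays one budget for its own output, one for the
  successful test that led to it, and one for the failing test that ends its list of children;
  the root of the call has not been tested inside the call.\<close>

definition gen_spec :: "nat \<Rightarrow> nat \<Rightarrow> nat \<Rightarrow> word \<Rightarrow> bool" where
  "gen_spec n s t \<gamma> \<longleftrightarrow> (\<forall>b m.
     map (m ''w'') [0..<n] = replicate s 1 @ replicate t 0 @ \<gamma> \<longrightarrow>
     (\<forall>j\<in>{1..n}. m ''F'' (b + j) = max_ones \<gamma> j) \<longrightarrow>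
     wp GeneratePN gen_body (frame [''n'', ''s'', ''t'', ''b''] [n, s, t, b]) m
       (\<lambda>l' m' ws T.
          map (m' ''w'') [0..<n] = replicate s 1 @ replicate t 0 @ \<gamma> \<and>
          (\<forall>k \<le> b + n. m' ''F'' k = m ''F'' k) \<and>
          distinct ws \<and> set ws = descendants s t \<gamma> \<and>
          T + budget n \<le> 3 * budget n * length ws))"

lemma map_fun_upd_nth: "map (f(k := x)) [0..<n] = (map f [0..<n])[k := x]"
  by (rule nth_equalityI) (auto simp: nth_list_update)

text \<open>During the loop the last 1 of the block is erased, leaving
  \<open>1^s 0^(t+1) \<gamma>\<close>; each child is then one cell write away and is undone by
  another.\<close>

lemma update_child:
  assumes "i \<le> t"
  shows "(replicate s 1 @ replicate (Suc t) 0 @ \<gamma>)[s + i := 1] = child s i t \<gamma>"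
    and "(child s i t \<gamma>)[s + i := 0] = replicate s 1 @ replicate (Suc t) 0 @ \<gamma>"
proof -
  have r: "replicate (Suc t) 0 = replicate i 0 @ 0 # replicate (t - i) (0::nat)"
    using assms by (metis Suc_diff_le le_Suc_eq le_add_diff_inverse replicate_Suc replicate_add)
  show "(replicate s 1 @ replicate (Suc t) 0 @ \<gamma>)[s + i := 1] = child s i t \<gamma>"
    unfolding r child_def by (simp add: list_update_append)
  show "(child s i t \<gamma>)[s + i := 0] = replicate s 1 @ replicate (Suc t) 0 @ \<gamma>"
    unfolding r child_def by (simp add: list_update_append)
qed

lemma Gen_proc: "GeneratePN ''Gen'' = Some ([''n'', ''s'', ''t'', ''b''], gen_body)"
  by (simp add: GeneratePN_def)

text \<open>A successful test is paid for by the budget that \<open>gen_spec\<close> leaves over in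
  the call on the child. A failing test lists no word, so its budget remains as a debt. The slack of
  20 covers the guard evaluations of the enclosing loop.\<close>

lemma gen_step_wp:
  fixes l :: locals and m :: arrays
  assumes spec: "prefix_normal (child s i t \<gamma>) \<Longrightarrow> gen_spec n s i (1 # replicate (t - i) 0 @ \<gamma>)"
    and l: "l ''n'' = n" "l ''s'' = Suc s" "l ''i'' = i" "1 \<le> i" "i \<le> t"
    and w: "map (m ''w'') [0..<n] = replicate s 1 @ replicate (Suc t) 0 @ \<gamma>"
    and F: "\<forall>j\<in>{1..n}. m ''F'' (l ''b'' + j) = max_ones \<gamma> j"
    and bin: "set \<gamma> \<subseteq> {0, 1}"
  shows "wp GeneratePN gen_step l m (\<lambda>l' m' ws T.
    (\<forall>v \<in> {''n'', ''s'', ''t'', ''b''}. l' v = l v) \<and> l' ''i'' = Suc i \<and>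
    l' ''ok'' = (if prefix_normal (child s i t \<gamma>) then 1 else 0) \<and>
    map (m' ''w'') [0..<n] = map (m ''w'') [0..<n] \<and>
    (\<forall>k \<le> l ''b'' + n. m' ''F'' k = m ''F'' k) \<and>
    distinct ws \<and> set ws = (if prefix_normal (child s i t \<gamma>) then sub_desc s i t \<gamma> else {}) \<and>
    T + 20 \<le> 3 * budget n * length ws +
              (if prefix_normal (child s i t \<gamma>) then 0 else budget n))"
proof -
  \<comment> \<open>The test takes at most \<open>70 * n + 50\<close>; the remaining 100 cover the
    commands around it and the slack.\<close>
  have budget: "70 * n + 150 \<le> budget n" by (simp add: budget_def)
  let ?u = "child s i t \<gamma>" and ?g = "1 # replicate (t - i) 0 @ \<gamma>"
  let ?m = "m(''w'' := (m ''w'')(s + i := 1))"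
  have w1: "map (?m ''w'') [0..<n] = ?u"
    using w update_child(1)[OF l(5)] by (simp add: map_fun_upd_nth)
  have bin1: "set ?u \<subseteq> {0, 1}" using bin by (auto simp: child_def)
  have drop: "drop (s + i) ?u = ?g" by (simp add: child_def)
  have len: "length ?u = n" using w1 by (metis diff_zero length_map length_upt)
  \<comment> \<open>The new suffix contributes its own prefix window and the windows of \<gamma>; by
    \<open>max_ones_zeros\<close> the 0s in between add nothing.\<close>
  have h: "max (?m ''F'' (l ''b'' + j)) (P (drop (s + l ''i'') ?u) j) = max_ones ?g j"
    if "j \<in> {1..n}" for j
    using that F l drop by (simp add: max_ones_zeros max.commute)
  have pn: "prefix_normal ?u \<longleftrightarrow> (\<forall>j\<in>{1..n}. max_ones ?g j \<le> P ?u j)"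
    using prefix_normal_block_iff[of s i ?g] len unfolding child_def by simp
  have test: "wp GeneratePN test_child l ?m (\<lambda>l' m' ws T.
    (\<forall>v \<in> {''n'', ''s'', ''t'', ''b'', ''i''}. l' v = l v) \<and> l' ''c'' = l ''b'' + n + 1 \<and>
    l' ''ok'' = (if prefix_normal ?u then 1 else 0) \<and>
    m' ''w'' = ?m ''w'' \<and> (\<forall>k \<le> l ''b'' + n + 1. m' ''F'' k = m ''F'' k) \<and>
    (\<forall>j\<in>{1..n}. m' ''F'' (l ''b'' + n + 1 + j) = max_ones ?g j) \<and>
    ws = [] \<and> T \<le> 70 * n + 50)"
    by (rule wp_mono[OF test_child_wp[of ?m n ?u l s, OF w1 bin1 l(1,2)]])
       (simp only: pn h cong: ball_cong, simp)
  have restore: "map (f(s + i := 0)) [0..<n] = map (m ''w'') [0..<n]"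
    if "map f [0..<n] = ?u" for f
    using that w update_child(2)[OF l(5)] by (simp add: map_fun_upd_nth)
  have restore1: "map ((m ''w'')(s + i := 0)) [0..<n] = map (m ''w'') [0..<n]"
    using restore[of "?m ''w''"] w1 by (simp del: map_eq_conv)
  show ?thesis
  proof (cases "prefix_normal ?u")
    case True
    have u: "?u = replicate s 1 @ replicate i 0 @ ?g" by (simp add: child_def)
    note gen = spec[OF True, unfolded gen_spec_def u[symmetric], rule_format]
    show ?thesis
      unfolding gen_step_def wp_Seq wp_Store
      apply (simp only: aval.simps l diff_Suc_1)
      apply (rule wp_mono[OF test], elim conjE)
      subgoal for l1 m1 ws1 T1
        using True w1 l budget
        apply (simp add: wp_Call[of GeneratePN, OF Gen_proc] del: One_nat_def map_eq_conv)
        apply (rule wp_mono[OF gen])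
          apply (simp del: map_eq_conv)
         apply simp
        apply (auto simp: restore simp del: map_eq_conv)
        done
      done
  next
    case False
    show ?thesis
      unfolding gen_step_def wp_Seq wp_Store
      apply (simp only: aval.simps l diff_Suc_1)
      apply (rule wp_mono[OF test], elim conjE)
      using False l budget restore1 by (auto simp del: map_eq_conv)
  qed
qed

text \<open>Tests and calls leave the cells of \<open>F\<close> up to \<open>b + n\<close> as they
  were, so every child starts from the same row. The loop ends at the first failing test, hence the
  single extra \<open>budget n\<close>.\<close>

lemma gen_loop_wp:
  fixes l :: locals and m :: arrays
  assumes spec: "\<And>i. i \<in> {1..t} \<Longrightarrow> prefix_normal (child s i t \<gamma>) \<Longrightarrow>
      gen_spec n s i (1 # replicate (t - i) 0 @ \<gamma>)"
    and bin: "set \<gamma> \<subseteq> {0, 1}"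
    and "l ''n'' = n" "l ''s'' = Suc s" "l ''t'' = t" "l ''b'' = b" "l ''i'' = i" "l ''ok'' = 1"
      "1 \<le> i" "i \<le> Suc t"
    and "map (m ''w'') [0..<n] = replicate s 1 @ replicate (Suc t) 0 @ \<gamma>"
    and "\<forall>j\<in>{1..n}. m ''F'' (b + j) = max_ones \<gamma> j"
  shows "wp GeneratePN
    (WHILE And (Less (N 0) (V ''ok'')) (Leq (V ''i'') (V ''t'')) DO gen_step) l m
    (\<lambda>l' m' ws T.
      l' ''n'' = n \<and> l' ''s'' = Suc s \<and>
      map (m' ''w'') [0..<n] = replicate s 1 @ replicate (Suc t) 0 @ \<gamma> \<and>
      (\<forall>k \<le> b + n. m' ''F'' k = m ''F'' k) \<and>
      distinct ws \<and> set ws = (\<Union>j\<in>{i..t}. sub_desc s j t \<gamma>) \<and>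
      T \<le> 3 * budget n * length ws + budget n)"
  using assms(3-)
proof (induction "Suc t - i" arbitrary: i l m)
  case 0
  then show ?case by (subst wp_While) (auto simp: budget_def simp del: map_eq_conv)
next
  case (Suc d)
  have i: "i \<in> {1..t}" "i \<le> t" using Suc.hyps(2) Suc.prems by auto
  have pos: "0 < l ''ok''" using Suc.prems by simp
  have F: "\<forall>j\<in>{1..n}. m ''F'' (l ''b'' + j) = max_ones \<gamma> j"
    using Suc.prems(4,10) by simp
  note step = gen_step_wp[of s i t \<gamma> n l m, OF spec[OF i(1)] Suc.prems(1,2,5,7) i(2)
      Suc.prems(9) F bin]
  let ?Q = "\<lambda>i m l' m' ws T.
      l' ''n'' = n \<and> l' ''s'' = Suc s \<and>
      map (m' ''w'') [0..<n] = replicate s 1 @ replicate (Suc t) 0 @ \<gamma> \<and>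
      (\<forall>k \<le> b + n. m' ''F'' k = m ''F'' k) \<and>
      distinct ws \<and> set ws = (\<Union>j\<in>{i..t}. sub_desc s j t \<gamma>) \<and>
      T \<le> 3 * budget n * length ws + budget n"
  have split: "{i..t} = insert i {Suc i..t}" using i by auto
  show ?case
  proof (cases "prefix_normal (child s i t \<gamma>)")
    case True
    show ?thesis
      apply (subst wp_While)
      apply (simp only: bval.simps aval.simps Suc.prems(3,5) pos i(2) simp_thms if_True)
      apply (rule wp_mono[OF step])
       apply assumption
      apply (elim conjE)
      subgoal premises p for l1 m1 ws1 T1
      proof (rule wp_mono[where Q = "?Q (Suc i) m1"], goal_cases)
        case 1
        show ?case
          by (rule Suc.hyps(1)) (use p Suc.hyps(2) Suc.prems i True in \<open>auto simp del: map_eq_conv\<close>)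
      next
        case (2 l2 m2 ws2 T2)
        \<comment> \<open>Disjointness keeps the concatenated output free of repetitions.\<close>
        have "sub_desc s i t \<gamma> \<inter> sub_desc s j t \<gamma> = {}" if "j \<in> {Suc i..t}" for j
          using that by (intro sub_desc_disjoint) auto
        then have "sub_desc s i t \<gamma> \<inter> (\<Union>j\<in>{Suc i..t}. sub_desc s j t \<gamma>) = {}" by blast
        then show ?case
          using 2 p Suc.prems i True
          by (auto simp: split distrib_left simp del: map_eq_conv)
      qed
      done
  next
    case False
    \<comment> \<open>Contrapositive of \<open>child_prefix_normal\<close>: a word in a later part
      would make child \<open>i\<close> prefix normal. Hence stopping here still yields the whole
      union.\<close>
    then have empty: "sub_desc s j t \<gamma> = {}" if "j \<in> {i..t}" for j
      using child_prefix_normal[of s j t \<gamma> i] that by auto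
    show ?thesis
      apply (subst wp_While)
      apply (simp only: bval.simps aval.simps Suc.prems(3,5) pos i(2) simp_thms if_True)
      apply (rule wp_mono[OF step])
       apply assumption
      apply (subst wp_While)
      using Suc.prems False empty by (auto simp del: map_eq_conv)
  qed
qed

lemma gen_body_unfold:
  "gen_body =
     Output ''w'' (N 0) (V ''n'') ;;
     (IF And (Less (N 0) (V ''s'')) (Less (N 0) (V ''t''))
      THEN
        Store ''w'' (Minus (V ''s'') (N 1)) (N 0) ;;
        ''i'' ::= N 1 ;;
        ''ok'' ::= N 1 ;;
        (WHILE And (Less (N 0) (V ''ok'')) (Leq (V ''i'') (V ''t'')) DO gen_step) ;;
        Store ''w'' (Minus (V ''s'') (N 1)) (N 1)
      ELSE Skip)"
  by (simp add: gen_body_def gen_step_def)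

text \<open>Induction on the number of leading 1s, which drops by one at each level of the
  recursion, while \<open>t\<close> and \<gamma> vary.\<close>

lemma gen_spec_correct:
  assumes "prefix_normal (replicate s 1 @ replicate t 0 @ \<gamma>)" "set \<gamma> \<subseteq> {0, 1}"
  shows "gen_spec n s t \<gamma>"
  using assms
proof (induction s arbitrary: t \<gamma>)
  case 0
  then show ?case
    by (auto simp: gen_spec_def gen_body_unfold frame_def slice_def budget_def descendants_0
        simp del: map_eq_conv)
next
  case (Suc s)
  show ?case
  proof (cases "t = 0")
    case True
    then show ?thesis using Suc.prems
      by (auto simp: gen_spec_def gen_body_unfold frame_def slice_def budget_def
          descendants_no_zeros simp del: map_eq_conv replicate_Suc)
  next
    case False
    let ?r = "replicate (Suc s) 1 @ replicate t 0 @ \<gamma>"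
    let ?z = "replicate s 1 @ replicate (Suc t) 0 @ \<gamma>"
    \<comment> \<open>Seeing the root as child 0 lets \<open>update_child\<close> also describe
      erasing and restoring the last 1 of the block.\<close>
    have r: "?r = child s 0 t \<gamma>" by (simp add: child_def replicate_append_same[symmetric])
    have upd: "?r[s := 0] = ?z" "?z[s := 1] = ?r"
      unfolding r using update_child[of 0 t s \<gamma>] by simp_all
    have spec: "gen_spec n s i (1 # replicate (t - i) 0 @ \<gamma>)"
      if "prefix_normal (child s i t \<gamma>)" for i
      using Suc.IH[of i "1 # replicate (t - i) 0 @ \<gamma>"] that Suc.prems(2)
      by (auto simp: child_def set_replicate_conv_if)
    have notin: "?r \<notin> (\<Union>i\<in>{1..t}. sub_desc s i t \<gamma>)"
      using root_notin_sub_desc by blast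
    show ?thesis
      unfolding gen_spec_def
    proof (intro allI impI)
      fix b and m :: arrays
      assume w: "map (m ''w'') [0..<n] = ?r"
        and F: "\<forall>j\<in>{1..n}. m ''F'' (b + j) = max_ones \<gamma> j"
      let ?l = "(frame [''n'', ''s'', ''t'', ''b''] [n, Suc s, t, b])(''i'' := 1, ''ok'' := 1)"
      let ?m = "m(''w'' := (m ''w'')(s := 0))"
      have w0: "map ((m ''w'')(s := 0)) [0..<n] = ?z"
        using w upd(1) by (simp only: map_fun_upd_nth)
      have w1: "map (f(s := 1)) [0..<n] = ?r" if "map f [0..<n] = ?z" for f
        using that upd(2) by (simp only: map_fun_upd_nth)
      have loop: "wp GeneratePN
        (WHILE And (Less (N 0) (V ''ok'')) (Leq (V ''i'') (V ''t'')) DO gen_step) ?l ?m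
        (\<lambda>l' m' ws T.
          l' ''n'' = n \<and> l' ''s'' = Suc s \<and> map (m' ''w'') [0..<n] = ?z \<and>
          (\<forall>k \<le> b + n. m' ''F'' k = ?m ''F'' k) \<and>
          distinct ws \<and> set ws = (\<Union>j\<in>{1..t}. sub_desc s j t \<gamma>) \<and>
          T \<le> 3 * budget n * length ws + budget n)"
        by (rule gen_loop_wp) (use spec Suc.prems w0 F in \<open>auto simp: frame_def simp del: map_eq_conv replicate_Suc\<close>)
      have vals: "frame [''n'', ''s'', ''t'', ''b''] [n, Suc s, t, b] ''n'' = n"
        "frame [''n'', ''s'', ''t'', ''b''] [n, Suc s, t, b] ''s'' = Suc s"
        "frame [''n'', ''s'', ''t'', ''b''] [n, Suc s, t, b] ''t'' = t"
        by (simp_all add: frame_def)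
      have budget: "n + 100 \<le> budget n" by (simp add: budget_def)
      show "wp GeneratePN gen_body (frame [''n'', ''s'', ''t'', ''b''] [n, Suc s, t, b]) m
       (\<lambda>l' m' ws T. map (m' ''w'') [0..<n] = ?r \<and> (\<forall>k \<le> b + n. m' ''F'' k = m ''F'' k) \<and>
          distinct ws \<and> set ws = descendants (Suc s) t \<gamma> \<and>
          T + budget n \<le> 3 * budget n * length ws)"
        unfolding gen_body_unfold wp_Seq wp_Output wp_If wp_Store wp_Assign
        using False
        apply (simp only: bval.simps aval.simps vals diff_Suc_1 if_True zero_less_Suc neq0_conv
            simp_thms)
        apply (rule wp_mono[OF loop], elim conjE)
        using w w1 notin Suc.prems(1) budget
        apply (auto simp: slice_def descendants_Suc simp del: map_eq_conv replicate_Suc)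
        done
    qed
  qed
qed

section \<open>The outer loop over all densities\<close>

lemma init_loop_wp:
  fixes l :: locals and m :: arrays
  assumes "l ''n'' = n" "l ''d'' = d" "l ''j'' = j" "j \<le> n"
    and "\<forall>k<j. m ''w'' k = (if k < d then 1 else 0)" "\<forall>k\<in>{1..j}. m ''F'' k = 0"
  shows "wp pr (WHILE Less (V ''j'') (V ''n'') DO init_step) l m (\<lambda>l' m' ws T.
    l' ''n'' = n \<and> l' ''d'' = d \<and>
    (\<forall>k<n. m' ''w'' k = (if k < d then 1 else 0)) \<and> (\<forall>k\<in>{1..n}. m' ''F'' k = 0) \<and>
    ws = [] \<and> T \<le> 30 * (n - j) + 10)"
  using assms
proof (induction "n - j" arbitrary: j l m)
  case 0
  then show ?case by (subst wp_While) auto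
next
  case (Suc x)
  have j: "j < n" using Suc.hyps(2) by simp
  have time: "30 * (n - j) = 30 * (n - Suc j) + 30" using j by simp
  let ?l = "l(''j'' := Suc j)"
  let ?m = "m(''w'' := (m ''w'')(j := if j < d then 1 else 0), ''F'' := (m ''F'')(Suc j := 0))"
  have loop: "wp pr (WHILE Less (V ''j'') (V ''n'') DO init_step) ?l ?m (\<lambda>l' m' ws T.
    l' ''n'' = n \<and> l' ''d'' = d \<and>
    (\<forall>k<n. m' ''w'' k = (if k < d then 1 else 0)) \<and> (\<forall>k\<in>{1..n}. m' ''F'' k = 0) \<and>
    ws = [] \<and> T \<le> 30 * (n - Suc j) + 10)"
    by (rule Suc.hyps(1)) (use Suc.hyps(2) Suc.prems j in \<open>auto simp: less_Suc_eq le_Suc_eq\<close>)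
  have step: "wp pr init_step l m (\<lambda>l' m' ws T. l' = ?l \<and> m' = ?m \<and> ws = [] \<and> T \<le> 25)"
    using Suc.prems by (auto simp: init_step_def)
  show ?case
    apply (subst wp_While)
    apply (simp only: bval.simps aval.simps Suc.prems(1,3) j if_True)
    apply (rule wp_mono[OF step], elim conjE, hypsubst)
    apply (rule wp_mono[OF loop], elim conjE)
    unfolding time by auto
qed

text \<open>A root is listed without a test, so the budget left over by \<open>gen_spec\<close> pays
  for writing the root word and clearing the first row.\<close>

lemma main_step_wp:
  fixes l :: locals and m :: arrays
  assumes "l ''n'' = n" "l ''d'' = d" "d \<le> n"
  shows "wp GeneratePN main_step l m (\<lambda>l' m' ws T. l' ''n'' = n \<and> l' ''d'' = Suc d \<and>
    distinct ws \<and> set ws = descendants d (n - d) [] \<and> T + 20 \<le> 3 * budget n * length ws)"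
proof -
  have spec: "gen_spec n d (n - d) []"
    by (rule gen_spec_correct) (use prefix_normal_root in simp_all)
  have root: "map f [0..<n] = replicate d 1 @ replicate (n - d) 0 @ []"
    if "\<forall>k<n. f k = (if k < d then 1 else 0)" for f :: "nat \<Rightarrow> nat"
    using that assms by (intro nth_equalityI) (auto simp: nth_append)
  note gen = spec[unfolded gen_spec_def, rule_format, of _ 0]
  have budget: "30 * n + 100 \<le> budget n" by (simp add: budget_def)
  show ?thesis
    unfolding main_step_def wp_Seq wp_Assign
    apply (rule wp_mono)
     apply (rule init_loop_wp[where n = n and d = d and j = 0])
          apply (use assms in simp_all)[6]
    apply (elim conjE)
    subgoal for l1 m1 ws1 T1
      apply (simp add: wp_Call[of GeneratePN, OF Gen_proc])
      apply (rule wp_mono[OF gen])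
        apply (rule root, simp)
       apply simp
      using budget by auto
    done
qed

text \<open>The densities are disjoint classes, and none is left after \<open>n\<close>, because a
  word has at most as many 1s as letters.\<close>

lemma main_loop_wp:
  fixes l :: locals and m :: arrays
  assumes "l ''n'' = n" "l ''d'' = d" "d \<le> Suc n"
  shows "wp GeneratePN (WHILE Leq (V ''d'') (V ''n'') DO main_step) l m (\<lambda>l' m' ws T.
    distinct ws \<and> set ws = {w \<in> L_PN. length w = n \<and> d \<le> ones w} \<and>
    T \<le> 3 * budget n * length ws + 10)"
  using assms
proof (induction "Suc n - d" arbitrary: d l m)
  case 0
  have "{w \<in> L_PN. length w = n \<and> d \<le> ones w} = {}"
    using 0(1) by (auto dest: le_trans[OF _ ones_le_length])
  then show ?case using 0 by (subst wp_While) auto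
next
  case (Suc x)
  have d: "d \<le> n" using Suc.hyps(2) by simp
  have desc: "descendants d (n - d) [] = {w \<in> L_PN. length w = n \<and> ones w = d}"
    using root_descendants[of n d] d by (simp only: if_True)
  have split: "{w \<in> L_PN. length w = n \<and> d \<le> ones w} =
      descendants d (n - d) [] \<union> {w \<in> L_PN. length w = n \<and> Suc d \<le> ones w}"
    "descendants d (n - d) [] \<inter> {w \<in> L_PN. length w = n \<and> Suc d \<le> ones w} = {}"
    unfolding desc by auto
  show ?case
    apply (subst wp_While)
    apply (simp only: bval.simps aval.simps Suc.prems(1,2) d if_True)
    apply (rule wp_mono[OF main_step_wp[OF Suc.prems(1,2) d]], elim conjE)
    subgoal for l1 m1 ws1 T1
      apply (rule wp_mono)
       apply (rule Suc.hyps(1)[of "Suc d"])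
         apply (use Suc.hyps(2) d in simp_all)[4]
      apply (elim conjE)
      unfolding split(1) using split(2) by (auto simp: distrib_left simp del: Un_iff)
    done
qed

lemma runs_GeneratePN:
  "\<exists>ws T. runs GeneratePN ''GeneratePN'' n ws T \<and> distinct ws \<and>
     set ws = {w \<in> L_PN. length w = n} \<and>
     T \<le> 800 * (n + 1) * card {w \<in> L_PN. length w = n}"
proof -
  let ?S = "{w \<in> L_PN. length w = n}"
  have main: "GeneratePN ''GeneratePN'' = Some ([''n''], main_body)"
    by (simp add: GeneratePN_def)
  have body: "main_body = ''d'' ::= N 0 ;; WHILE Leq (V ''d'') (V ''n'') DO main_step"
    by (simp add: main_body_def main_step_def init_step_def)
  have "wp GeneratePN (Call ''GeneratePN'' [V ''n'']) (frame [''n''] [n]) (\<lambda>_ _. 0)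
    (\<lambda>l' m' ws T. l' = frame [''n''] [n] \<and> distinct ws \<and> set ws = ?S \<and>
       T \<le> 3 * budget n * length ws + 20)"
    unfolding wp_Call[of GeneratePN, OF main, of "[V ''n'']", simplified] body wp_Seq wp_Assign
    apply (rule wp_mono)
     apply (rule main_loop_wp[where n = n and d = 0])
    by (auto simp: frame_def)
  then obtain m' ws T where run: "exec GeneratePN (Call ''GeneratePN'' [V ''n'']) (frame [''n''] [n])
      (\<lambda>_ _. 0) (frame [''n''] [n]) m' ws T"
    and ws: "distinct ws" "set ws = ?S" and T: "T \<le> 3 * budget n * length ws + 20"
    by (auto elim: wpE)
  \<comment> \<open>The word of 0s is always listed, so the additive 20 fits into one more budget
    per word: 3 * 200 + 200 = 800.\<close>
  have "replicate n 0 \<in> ?S" using prefix_normal_root[of 0 n] by (auto simp: L_PN_def)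
  then have "length ws \<ge> 1" using ws(2) by (cases ws) auto
  then have "20 * 1 \<le> budget n * length ws" by (intro mult_mono) (auto simp: budget_def)
  then have "T \<le> 800 * (n + 1) * card ?S"
    using T distinct_card[OF ws(1)] ws(2) by (simp add: budget_def algebra_simps)
  with run ws show ?thesis unfolding runs_def by blast
qed

theorem theorem1:
  "\<exists>T :: nat \<Rightarrow> nat.
     (\<forall>n. \<exists>ws. runs GeneratePN ''GeneratePN'' n ws (T n) \<and>
               distinct ws \<and>
               set ws = {w \<in> L_PN. length w = n}) \<and>
     (\<lambda>n. real (T n)) \<in> O(\<lambda>n. real (n * card {w \<in> L_PN. length w = n}))"
proof -
  have "\<forall>n. \<exists>T ws. runs GeneratePN ''GeneratePN'' n ws T \<and> distinct ws \<and>
      set ws = {w \<in> L_PN. length w = n} \<and>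
      T \<le> 800 * (n + 1) * card {w \<in> L_PN. length w = n}"
    using runs_GeneratePN by blast
  from choice[OF this] obtain T where T: "\<And>n. \<exists>ws. runs GeneratePN ''GeneratePN'' n ws (T n) \<and> distinct ws \<and>
      set ws = {w \<in> L_PN. length w = n} \<and>
      T n \<le> 800 * (n + 1) * card {w \<in> L_PN. length w = n}"
    by blast
  \<comment> \<open>At \<open>n = 0\<close> the comparison function vanishes; from
    \<open>n = 1\<close> on, \<open>n + 1\<close> is at most \<open>2 * n\<close>, which doubles 800
    to 1600.\<close>
  have "real (T n) \<le> 1600 * real (n * card {w \<in> L_PN. length w = n})" if "n \<ge> 1" for n
  proof -
    have "T n \<le> 800 * (n + 1) * card {w \<in> L_PN. length w = n}" using T by blast
    also have "\<dots> \<le> 1600 * n * card {w \<in> L_PN. length w = n}"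
      using that by (intro mult_right_mono) auto
    finally have "real (T n) \<le> real (1600 * n * card {w \<in> L_PN. length w = n})"
      by (rule of_nat_mono)
    then show ?thesis by (simp add: mult.assoc)
  qed
  then have "(\<lambda>n. real (T n)) \<in> O(\<lambda>n. real (n * card {w \<in> L_PN. length w = n}))"
    by (intro bigoI[of _ 1600] eventually_sequentiallyI[of 1]) simp
  with T show ?thesis by blast
qed

end
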